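(* Let $\mathbb{F}$ be an algebraically closed field of characteristic not $2$ and not $3$. The derivation algebras of the $2$-dimensional evolution algebras $E_1(b,c)$ ($b,c\in\mathbb{F}$, $bc\ne1$), $E_2(b)$ ($b\in\mathbb{F}$), $E_3$, $E_4$, $E_5$, $E_6$ over $\mathbb{F}$ are as follows: \begin{itemize} \item $Der(E_1(b,c))=\{0\}$; \item $Der(E_2(b))=\{0\}$ if $b\neq0$; \item $Der(E_2(0))=\left\{\begin{pmatrix}0&0\\t&-t\end{pmatrix}: t\in\mathbb{F}\right\}$; \item $Der(E_3)=Der(E_4)=\{0\}$; \item $Der(E_5)=\left\{\begin{pmatrix}-t&t\\t&-t\end{pmatrix}: t\in\mathbb{F}\right\}$; \item $Der(E_6)=\left\{\begin{pmatrix}2t&s\\0&t\end{pmatrix}: t,s\in\mathbb{F}\right\}$. \end{itemize}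
   Context: A $2$-dimensional algebra over $\mathbb{F}$ with basis $(e_1,e_2)$ and $e_i\cdot e_j=A^1_{i,j}e_1+A^2_{i,j}e_2$ is identified with its matrix of structure constants $$A=\begin{pmatrix} A^1_{1,1}&A^1_{1,2}&A^1_{2,1}&A^1_{2,2}\\ A^2_{1,1}&A^2_{1,2}&A^2_{2,1}&A^2_{2,2}\end{pmatrix},$$ so that in coordinate column vectors the product of $u$ and $v$ is $A(u\otimes v)$ (Kronecker product). The algebras considered (up to isomorphism, all the nontrivial $2$-dimensional evolution algebras over $\mathbb{F}$, i.e. algebras with nonzero multiplication having a basis with $e_1e_2=e_2e_1=0$) are $$E_{1}(b,c)=\begin{pmatrix} 1 & 0 & 0 & b\\ c & 0 & 0 & 1\end{pmatrix}\ (bc\neq1),\quad E_{2}(b)=\begin{pmatrix} 1 & 0 & 0 & b\\ 1 & 0 & 0 & 0\end{pmatrix},\quad E_{3}=\begin{pmatrix} 0 & 0 & 0 & 1\\ 1 & 0 & 0 & 0\end{pmatrix},$$ $$E_{4}=\begin{pmatrix} 1 & 0 & 0 & 1\\ 0 & 0 & 0 & 0\end{pmatrix},\quad E_5=\begin{pmatrix} 1 & 0 & 0 & -1\\ -1 & 0 & 0 & 1\end{pmatrix},\quad E_{6}=\begin{pmatrix} 0 & 0 & 0 & 1\\ 0 & 0 & 0 & 0\end{pmatrix}.$$ For an algebra with matrix of structure constants $E$, its algebra of derivations is $Der(E)=\{D\in M(2;\mathbb{F}):\ E(D\otimes I+I\otimes D)-DE=0\}$, where $M(2;\mathbb{F})$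 is the set of $2\times2$ matrices over $\mathbb{F}$ and $I$ is the $2\times 2$ identity matrix. *)

theory Defs
  imports
    "Jordan_Normal_Form.Matrix"
    "HOL-Computational_Algebra.Polynomial"
begin

definition kronecker :: "'a :: times mat \<Rightarrow> 'a mat \<Rightarrow> 'a mat" where
  "kronecker A B =
     mat (dim_row A * dim_row B) (dim_col A * dim_col B)
       (\<lambda>(i, j). A $$ (i div dim_row B, j div dim_col B) * B $$ (i mod dim_row B, j mod dim_col B))"

text \<open>
  A two-dimensional algebra with basis \<open>(e\<^sub>1, e\<^sub>2)\<close> is given by its \<open>2 \<times> 4\<close> matrix of structure
  constants: the columns hold the coordinates of
  \<open>e\<^sub>1 e\<^sub>1, e\<^sub>1 e\<^sub>2, e\<^sub>2 e\<^sub>1, e\<^sub>2 e\<^sub>2\<close>, in this order.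
\<close>

definition Der :: "'a :: comm_ring_1 mat \<Rightarrow> 'a mat set" where
  "Der E = {D \<in> carrier_mat 2 2.
     E * (kronecker D (1\<^sub>m 2) + kronecker (1\<^sub>m 2) D) - D * E = 0\<^sub>m 2 4}"

definition E1 :: "'a :: comm_ring_1 \<Rightarrow> 'a \<Rightarrow> 'a mat" where
  "E1 b c = mat_of_rows_list 4 [[1, 0, 0, b], [c, 0, 0, 1]]"

definition E2 :: "'a :: comm_ring_1 \<Rightarrow> 'a mat" where
  "E2 b = mat_of_rows_list 4 [[1, 0, 0, b], [1, 0, 0, 0]]"

definition E3 :: "'a :: comm_ring_1 mat" where
  "E3 = mat_of_rows_list 4 [[0, 0, 0, 1], [1, 0, 0, 0]]"

definition E4 :: "'a :: comm_ring_1 mat" where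
  "E4 = mat_of_rows_list 4 [[1, 0, 0, 1], [0, 0, 0, 0]]"

definition E5 :: "'a :: comm_ring_1 mat" where
  "E5 = mat_of_rows_list 4 [[1, 0, 0, -1], [-1, 0, 0, 1]]"

definition E6 :: "'a :: comm_ring_1 mat" where
  "E6 = mat_of_rows_list 4 [[0, 0, 0, 1], [0, 0, 0, 0]]"

end

theory Submission
  imports Defs
begin

text \<open>
  For an evolution algebra with \<open>e\<^sub>1 e\<^sub>1 = (a, c)\<close> and \<open>e\<^sub>2 e\<^sub>2 = (b, d)\<close>, the Leibniz rule on the
  products of basis vectors gives six linear equations in the entries of the derivation (the
  products \<open>e\<^sub>1 e\<^sub>2\<close> and \<open>e\<^sub>2 e\<^sub>1\<close> give the same ones). These are solved case by case; the
  characteristic enters through \<open>E\<^sub>2\<close> and \<open>E\<^sub>4\<close>, where \<open>2 \<noteq> 0\<close> is needed, and through \<open>E\<^sub>3\<close>, where the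
  equations \<open>s = 2 p\<close> and \<open>p = 2 s\<close> give \<open>3 p = 0\<close>.
\<close>

lemma mat_of_rows_list_2_2_eq_iff:
  "mat_of_rows_list 2 [[p, q], [r, s]] = mat_of_rows_list 2 [[p', q'], [r', s']]
    \<longleftrightarrow> p = p' \<and> q = q' \<and> r = r' \<and> s = s'"
  by (auto simp: mat_eq_iff mat_of_rows_list_def numeral_2_eq_2 All_less_Suc)

lemma zero_mat_2_2: "(0\<^sub>m 2 2 :: 'a :: zero mat) = mat_of_rows_list 2 [[0, 0], [0, 0]]"
  by (auto simp: mat_eq_iff mat_of_rows_list_def numeral_2_eq_2 All_less_Suc)

lemma carrier_mat_2_2_cases:
  assumes "D \<in> carrier_mat 2 2"
  obtains p q r s where "D = mat_of_rows_list 2 [[p, q], [r, s]]"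
proof
  show "D = mat_of_rows_list 2 [[D $$ (0, 0), D $$ (0, 1)], [D $$ (1, 0), D $$ (1, 1)]]"
    using assms by (auto simp: mat_eq_iff mat_of_rows_list_def numeral_2_eq_2 All_less_Suc)
qed

text \<open>The equations come in pairs, one pair per column of the matrix identity:
  \<open>e1 e1\<close>, then the mixed products, then \<open>e2 e2\<close>. The columns of the
  matrix are the images \<open>(p, r)\<close> of \<open>e1\<close> and \<open>(q, s)\<close> of
  \<open>e2\<close>.\<close>

lemma mem_Der_evolution_iff:
  fixes a b c d p q r s :: "'a :: comm_ring_1"
  shows "mat_of_rows_list 2 [[p, q], [r, s]] \<in> Der (mat_of_rows_list 4 [[a, 0, 0, b], [c, 0, 0, d]])
    \<longleftrightarrow> a * p + c * q = 2 * p * a \<and> a * r + c * s = 2 * p * c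
      \<and> q * a + r * b = 0 \<and> q * c + r * d = 0
      \<and> b * p + d * q = 2 * s * b \<and> b * r + d * s = 2 * s * d"
proof -
  \<comment> \<open>The index facts follow the simplifier's normal forms: \<open>1\<close> becomes
    \<open>Suc 0\<close>, while \<open>2\<close> and \<open>3\<close> stay numerals.\<close>
  have less2: "(\<forall>j<2. P j) \<longleftrightarrow> P 0 \<and> P (Suc 0)" for P :: "nat \<Rightarrow> bool"
    by (auto simp: less_Suc_eq numeral_eq_Suc)
  have less4: "(\<forall>j<4. P j) \<longleftrightarrow> P 0 \<and> P (Suc 0) \<and> P 2 \<and> P 3" for P :: "nat \<Rightarrow> bool"
    by (auto simp: less_Suc_eq numeral_eq_Suc)
  have up2: "{0..<2} = {0, Suc 0}" and up4: "{0..<4} = {0, Suc 0, 2, 3 :: nat}" by auto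
  have div_mod_2: "3 div 2 = Suc 0" "3 mod 2 = Suc 0" "Suc 0 div 2 = 0" "Suc 0 mod 2 = Suc 0"
    "2 div 2 = Suc 0" "2 mod 2 = (0 :: nat)"
    by simp_all
  have nths: "xs ! 3 = xs ! Suc (Suc (Suc 0))" "xs ! 2 = xs ! Suc (Suc 0)" for xs :: "'a list"
    by (simp_all add: numeral_eq_Suc)
  have dims: "length [x, y] = 2" for x y :: "'a list" by simp
  show ?thesis
    unfolding Der_def mat_of_rows_list_def dims
    by (simp add: mat_eq_iff kronecker_def less4 less2 scalar_prod_def up4 up2 div_mod_2 nths)
      (auto simp: algebra_simps)
qed

lemma Der_evolution:
  fixes a b c d :: "'a :: comm_ring_1"
  shows "Der (mat_of_rows_list 4 [[a, 0, 0, b], [c, 0, 0, d]]) =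
    {mat_of_rows_list 2 [[p, q], [r, s]] | p q r s.
      a * p + c * q = 2 * p * a \<and> a * r + c * s = 2 * p * c
      \<and> q * a + r * b = 0 \<and> q * c + r * d = 0
      \<and> b * p + d * q = 2 * s * b \<and> b * r + d * s = 2 * s * d}" (is "?L = ?R")
proof
  show "?L \<subseteq> ?R"
  proof
    fix D assume D: "D \<in> ?L"
    then have "D \<in> carrier_mat 2 2" by (simp add: Der_def)
    then obtain p q r s where "D = mat_of_rows_list 2 [[p, q], [r, s]]"
      by (rule carrier_mat_2_2_cases)
    with D show "D \<in> ?R" unfolding mem_Collect_eq using mem_Der_evolution_iff by blast
  qed
  show "?R \<subseteq> ?L" using mem_Der_evolution_iff by blast
qed

lemma Der_evolution_eq_zero:
  fixes a b c d :: "'a :: comm_ring_1"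
  assumes "\<And>p q r s. \<lbrakk>a * p + c * q = 2 * p * a; a * r + c * s = 2 * p * c; q * a + r * b = 0;
      q * c + r * d = 0; b * p + d * q = 2 * s * b; b * r + d * s = 2 * s * d\<rbrakk>
    \<Longrightarrow> p = 0 \<and> q = 0 \<and> r = 0 \<and> s = 0"
  shows "Der (mat_of_rows_list 4 [[a, 0, 0, b], [c, 0, 0, d]]) = {0\<^sub>m 2 2}" (is "?L = _")
proof
  show "?L \<subseteq> {0\<^sub>m 2 2}"
    unfolding Der_evolution zero_mat_2_2 using assms by blast
  show "{0\<^sub>m 2 2} \<subseteq> ?L"
    by (simp add: zero_mat_2_2 mem_Der_evolution_iff)
qed

text \<open>If p vanished, the characteristic would divide the prime p, hence be 1 or p; the value 1
  would force 1 = 0.\<close>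

lemma of_nat_prime_neq_0:
  assumes "CHAR('a :: semiring_1) \<noteq> p" and "prime p" and "(1 :: 'a) \<noteq> 0"
  shows "(of_nat p :: 'a) \<noteq> 0"
  using assms by (auto simp: of_nat_eq_0_iff_char_dvd prime_nat_iff)

theorem theorem4p1:
  assumes "CHAR('a :: alg_closed_field) \<noteq> 2" and "CHAR('a) \<noteq> 3"
  shows "(\<forall>b c :: 'a. b * c \<noteq> 1 \<longrightarrow> Der (E1 b c) = {0\<^sub>m 2 2})
    \<and> (\<forall>b :: 'a. b \<noteq> 0 \<longrightarrow> Der (E2 b) = {0\<^sub>m 2 2})
    \<and> Der (E2 (0 :: 'a)) = {mat_of_rows_list 2 [[0, 0], [t, -t]] | t. True}
    \<and> Der (E3 :: 'a mat) = {0\<^sub>m 2 2}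
    \<and> Der (E4 :: 'a mat) = {0\<^sub>m 2 2}
    \<and> Der (E5 :: 'a mat) = {mat_of_rows_list 2 [[-t, t], [t, -t]] | t. True}
    \<and> Der (E6 :: 'a mat) = {mat_of_rows_list 2 [[2 * t, s], [0, t]] | t s. True}"
proof -
  have two: "(2 :: 'a) \<noteq> 0" using of_nat_prime_neq_0[OF assms(1)] by simp
  have three: "(3 :: 'a) \<noteq> 0" using of_nat_prime_neq_0[OF assms(2)] by simp
  \<comment> \<open>Cancelling in \<open>p = 2 * p\<close> leaves the alternative
    \<open>2 = 1\<close>, which this excludes.\<close>
  have two_neq_one: "(2 :: 'a) \<noteq> 1" using add_cancel_left_left one_add_one zero_neq_one by metis
  have E1: "Der (E1 b c) = {0\<^sub>m 2 2}" if bc: "b * c \<noteq> 1" for b c :: 'a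
    unfolding E1_def
  proof (rule Der_evolution_eq_zero)
    fix p q r s :: 'a
    assume p: "1 * p + c * q = 2 * p * 1" and s: "b * r + 1 * s = 2 * s * 1"
      and qr: "q * 1 + r * b = 0" "q * c + r * 1 = 0"
    \<comment> \<open>The mixed products give a linear system in q and r with determinant
      \<open>1 - b * c\<close>; here q is eliminated.\<close>
    have "r * (1 - b * c) = (q * c + r * 1) - (q * 1 + r * b) * c"
      by (simp add: algebra_simps)
    then have r: "r = 0" using qr bc by simp
    with qr have q: "q = 0" by simp
    from p s show "p = 0 \<and> q = 0 \<and> r = 0 \<and> s = 0"
      unfolding q r by (simp add: two_neq_one)
  qed
  \<comment> \<open>One mixed equation is \<open>q = 0\<close>, which leaves
    \<open>p = 2 * p\<close> and \<open>r * b = 0\<close>; the latter is where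
    \<open>b \<noteq> 0\<close> enters.\<close>
  have E2: "Der (E2 b) = {0\<^sub>m 2 2}" if b: "b \<noteq> 0" for b :: 'a
    unfolding E2_def using b two
    by (intro Der_evolution_eq_zero) (simp add: two_neq_one)
  \<comment> \<open>For b = 0 the constraint \<open>r * b = 0\<close> disappears: p and q still
    vanish, but only \<open>r + s = 0\<close> remains for r and s.\<close>
  have E20: "Der (E2 (0 :: 'a)) = {mat_of_rows_list 2 [[0, 0], [t, -t]] | t. True}"
    unfolding E2_def Der_evolution
    by (auto simp: two_neq_one mat_of_rows_list_2_2_eq_iff add_eq_0_iff)
  have E3: "Der (E3 :: 'a mat) = {0\<^sub>m 2 2}"
    unfolding E3_def
  proof (rule Der_evolution_eq_zero)
    fix p q r s :: 'a
    assume "0 * r + 1 * s = 2 * p * 1" "1 * p + 0 * q = 2 * s * 1"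
      and qr: "q * 0 + r * 1 = 0" "q * 1 + r * 0 = 0"
    then have s: "s = 2 * p" and p: "p = 2 * s" by simp_all
    have "3 * p = 2 * s - p" unfolding s by simp
    then have "3 * p = 0" unfolding p[symmetric] by simp
    with three have "p = 0" by simp
    with s qr show "p = 0 \<and> q = 0 \<and> r = 0 \<and> s = 0" by simp
  qed
  \<comment> \<open>Since p = 0, the equation \<open>p = 2 * s\<close> yields s = 0 because
    \<open>2 \<noteq> 0\<close>.\<close>
  have E4: "Der (E4 :: 'a mat) = {0\<^sub>m 2 2}"
    unfolding E4_def using two by (intro Der_evolution_eq_zero) (simp add: two_neq_one)
  have E5: "Der (E5 :: 'a mat) = {mat_of_rows_list 2 [[-t, t], [t, -t]] | t. True}"
  proof -
    \<comment> \<open>These three equations already cut out the line of solutions, parametrised by t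
      = q.\<close>
    have "p = - q \<and> r = q \<and> s = - q"
      if "p - q = 2 * p" "r - s = - (2 * p)" "q - r = 0" for p q r s :: 'a
    proof -
      have "- q = 2 * p - p" unfolding that(1)[symmetric] by simp
      then have "p = - q" by simp
      moreover have "r = q" using that(3) by simp
      moreover have "s = r + 2 * p" using that(2) by (simp add: algebra_simps)
      ultimately show ?thesis by simp
    qed
    then show ?thesis unfolding E5_def Der_evolution
      by (auto simp: mat_of_rows_list_2_2_eq_iff)
  qed
  \<comment> \<open>Only \<open>r = 0\<close> and \<open>p = 2 * s\<close> survive, so q and s are
    the free parameters.\<close>
  have E6: "Der (E6 :: 'a mat) = {mat_of_rows_list 2 [[2 * t, s], [0, t]] | t s. True}"
    unfolding E6_def Der_evolution by (auto simp: mat_of_rows_list_2_2_eq_iff)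
  show ?thesis using E1 E2 E20 E3 E4 E5 E6 by blast
qed

end
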